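(* Let $A = \{a_1, a_2, a_3, \dots\}$ be the set of the terms of an infinite arithmetic (respectively geometric) progression of real numbers. Then for any partition $A = A_1 \cup A_2$ into two disjoint subsets, at least one of $A_1, A_2$ contains at least three terms in arithmetic (respectively geometric) progression.
   Context: An infinite arithmetic progression is a sequence $a_n = a_1 + (n-1)r$, $n \ge 1$; an infinite geometric progression is a sequence $a_n = a_1 r^{n-1}$, $n\ge 1$, with $a_1 \neq 0$ and $r \ne 0$. "Infinite" means that the sequence takes infinitely many distinct values. Three terms in arithmetic progression are three pairwise distinct numbers $x,y,z$ with $2y = x+z$; three terms in geometric progression are three pairwise distinct nonzero numbers $x,y,z$ with $y^2 = xz$. The statement comprises two assertions, one for arithmetic and one for geometric progressions. *)

theory Defs
  imports Complex_Main
begin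

(* Sequences are functions on nat of which only the values at n >= 1 matter. *)

definition terms :: "(nat \<Rightarrow> real) \<Rightarrow> real set" where
  "terms a = {a n | n. n \<ge> 1}"

(* Infinite progressions take infinitely many distinct values; this excludes
   common difference 0 and common ratios 1 and -1, respectively. *)

definition infinite_arithmetic_progression :: "(nat \<Rightarrow> real) \<Rightarrow> bool" where
  "infinite_arithmetic_progression a \<longleftrightarrow>
     (\<exists>r. \<forall>n\<ge>1. a n = a 1 + (real n - 1) * r) \<and> infinite (terms a)"

definition infinite_geometric_progression :: "(nat \<Rightarrow> real) \<Rightarrow> bool" where
  "infinite_geometric_progression a \<longleftrightarrow>
     a 1 \<noteq> 0 \<and> (\<exists>r. r \<noteq> 0 \<and> (\<forall>n\<ge>1. a n = a 1 * r ^ (n - 1))) \<and> infinite (terms a)"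

definition three_in_arithmetic_progression :: "real \<Rightarrow> real \<Rightarrow> real \<Rightarrow> bool" where
  "three_in_arithmetic_progression x y z \<longleftrightarrow>
     x \<noteq> y \<and> y \<noteq> z \<and> x \<noteq> z \<and> 2 * y = x + z"

definition three_in_geometric_progression :: "real \<Rightarrow> real \<Rightarrow> real \<Rightarrow> bool" where
  "three_in_geometric_progression x y z \<longleftrightarrow>
     x \<noteq> y \<and> y \<noteq> z \<and> x \<noteq> z \<and> x \<noteq> 0 \<and> y \<noteq> 0 \<and> z \<noteq> 0 \<and> y\<^sup>2 = x * z"

definition contains_three_term_ap :: "real set \<Rightarrow> bool" where
  "contains_three_term_ap S \<longleftrightarrow>
     (\<exists>x\<in>S. \<exists>y\<in>S. \<exists>z\<in>S. three_in_arithmetic_progression x y z)"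

definition contains_three_term_gp :: "real set \<Rightarrow> bool" where
  "contains_three_term_gp S \<longleftrightarrow>
     (\<exists>x\<in>S. \<exists>y\<in>S. \<exists>z\<in>S. three_in_geometric_progression x y z)"

end

theory Submission
  imports Defs
begin

text \<open>Colour each index by the part that contains the corresponding term. By the van der
  Waerden bound \<open>W(3; 2) = 9\<close>, three of the indices \<open>1, \<dots>, 9\<close> in arithmetic progression
  have the same colour, and an index progression \<open>i, i + d, i + 2d\<close> is mapped to a progression
  of terms. These terms are distinct because an infinite progression is injective.\<close>

lemma van_der_Waerden_3_2:
  fixes P :: "nat \<Rightarrow> bool"
  obtains i d where "i \<ge> 1" "d \<ge> 1" "P (i + d) = P i" "P (i + 2 * d) = P i"
proof -
  have "\<exists>i\<ge>1. \<exists>d\<ge>1. P (i + d) = P i \<and> P (i + 2 * d) = P i"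
  proof (rule ccontr)
    assume "\<not> ?thesis"
    then have no: "\<not> (P (i + d) = P i \<and> P (i + 2 * d) = P i)" if "i \<ge> 1" "d \<ge> 1" for i d
      using that by blast
    \<comment> \<open>These sixteen instances are all the three-term progressions inside {1, ...,
      9}: 7, 5, 3 and 1 of them for differences 1 to 4. What remains is a propositional
      contradiction in the colours of nine indices; the unfoldings give the indices 2 and 3 one form
      each, so that their atoms agree.\<close>
    show False
      using no[of 1 1, simplified] no[of 2 1, simplified] no[of 3 1, simplified] no[of 4 1, simplified] no[of 5 1, simplified] no[of 6 1, simplified] no[of 7 1, simplified]
        no[of 1 2, simplified] no[of 2 2, simplified] no[of 3 2, simplified] no[of 4 2, simplified] no[of 5 2, simplified]
        no[of 1 3, simplified] no[of 2 3, simplified] no[of 3 3, simplified] no[of 1 4, simplified]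
      unfolding numeral_2_eq_2 numeral_3_eq_3 by argo
  qed
  then show ?thesis
    using that by blast
qed

text \<open>The colour of an index \<open>n\<close> is the truth value of
  \<open>a n \<in> A1\<close>. A term outside \<open>A1\<close> lies in \<open>A2\<close> because
  the parts cover all terms, so equal colours mean a common part.\<close>

lemma partition_terms_monochromatic:
  assumes "terms a = A1 \<union> A2"
  obtains i d S where "i \<ge> 1" "d \<ge> 1" "S \<in> {A1, A2}" "a i \<in> S" "a (i + d) \<in> S" "a (i + 2 * d) \<in> S"
proof -
  obtain i d where id: "i \<ge> 1" "d \<ge> 1"
    "(a (i + d) \<in> A1) = (a i \<in> A1)" "(a (i + 2 * d) \<in> A1) = (a i \<in> A1)"
    by (rule van_der_Waerden_3_2)
  have "a n \<in> A1 \<union> A2" if "n \<ge> 1" for n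
    using assms that unfolding terms_def by blast
  from this[of i] this[of "i + d"] this[of "i + 2 * d"]
  have "a i \<in> A1 \<union> A2" "a (i + d) \<in> A1 \<union> A2" "a (i + 2 * d) \<in> A1 \<union> A2"
    using id by simp_all
  then show ?thesis
    using id that by blast
qed

text \<open>The three terms have common difference \<open>d * r\<close>. It is nonzero, since
  \<open>r = 0\<close> would leave the single value \<open>a 1\<close>.\<close>

lemma arithmetic_progression_three_terms:
  assumes "infinite_arithmetic_progression a" "i \<ge> 1" "d \<ge> 1"
  shows "three_in_arithmetic_progression (a i) (a (i + d)) (a (i + 2 * d))"
proof -
  from assms(1) obtain r where r: "\<And>n. n \<ge> 1 \<Longrightarrow> a n = a 1 + (real n - 1) * r"
    and inf: "infinite (terms a)"
    unfolding infinite_arithmetic_progression_def by blast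
  have "r \<noteq> 0"
  proof
    assume "r = 0"
    then have "a n = a 1" if "n \<ge> 1" for n
      using r[OF that] by simp
    then have "terms a \<subseteq> {a 1}"
      unfolding terms_def by blast
    then show False
      using inf finite_subset by blast
  qed
  moreover have "a (i + d) = a i + d * r" "a (i + 2 * d) = a i + 2 * (d * r)"
    using r[of i] r[of "i + d"] r[of "i + 2 * d"] assms by (simp_all add: algebra_simps)
  ultimately show ?thesis
    using \<open>d \<ge> 1\<close> by (simp add: three_in_arithmetic_progression_def)
qed

text \<open>The three terms have common ratio \<open>r ^ d\<close>. If
  \<open>\<bar>r\<bar> = 1\<close>, every term would be \<open>a 1\<close> or \<open>- a 1\<close>,
  contradicting infinitude; hence no positive power of \<open>r\<close> equals 1.\<close>

lemma geometric_progression_three_terms: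
  assumes "infinite_geometric_progression a" "i \<ge> 1" "d \<ge> 1"
  shows "three_in_geometric_progression (a i) (a (i + d)) (a (i + 2 * d))"
proof -
  from assms(1) obtain r where r: "\<And>n. n \<ge> 1 \<Longrightarrow> a n = a 1 * r ^ (n - 1)"
    and nz: "a 1 \<noteq> 0" "r \<noteq> 0" and inf: "infinite (terms a)"
    unfolding infinite_geometric_progression_def by blast
  have "\<bar>r\<bar> \<noteq> 1"
  proof
    assume "\<bar>r\<bar> = 1"
    then have "\<bar>r ^ n\<bar> = 1" for n
      by (simp add: power_abs)
    then have "r ^ n \<in> {1, - 1}" for n
      by (simp add: abs_eq_iff')
    then have "a n \<in> {a 1, - a 1}" if "n \<ge> 1" for n
      using r[OF that] by fastforce
    then have "terms a \<subseteq> {a 1, - a 1}"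
      unfolding terms_def by blast
    then show False
      using inf finite_subset by blast
  qed
  then have "r ^ m \<noteq> 1" if "m \<ge> 1" for m
    using that power_eq_1_iff[of r m] by force
  \<comment> \<open>Exponent \<open>d\<close> separates neighbouring terms. Exponent
    \<open>2 * d\<close> separates the outer two, which would coincide if
    \<open>r ^ d = - 1\<close>.\<close>
  from this[of d] this[of "2 * d"] have q: "r ^ d \<noteq> 1" "(r ^ d)\<^sup>2 \<noteq> 1"
    using \<open>d \<ge> 1\<close> by (simp_all add: power_even_eq)
  have "a i \<noteq> 0"
    using r[of i] nz \<open>i \<ge> 1\<close> by simp
  moreover have "a (i + d) = a i * r ^ d" "a (i + 2 * d) = a i * (r ^ d)\<^sup>2"
    using r[of i] r[of "i + d"] r[of "i + 2 * d"] assms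
    \<comment> \<open>Flipped \<open>power_mult\<close> turns the square into the exponent
      \<open>d * 2\<close>, so \<open>2 * d\<close> is commuted to match it.\<close>
    by (simp_all add: mult.commute[of 2] flip: power_add power_mult)
  ultimately show ?thesis
    using q nz by (simp add: three_in_geometric_progression_def power2_eq_square)
qed

theorem theorem1:
  shows "(\<forall>(a :: nat \<Rightarrow> real) A1 A2.
            infinite_arithmetic_progression a \<longrightarrow>
            terms a = A1 \<union> A2 \<longrightarrow> A1 \<inter> A2 = {} \<longrightarrow>
            contains_three_term_ap A1 \<or> contains_three_term_ap A2)
       \<and> (\<forall>(a :: nat \<Rightarrow> real) A1 A2.
            infinite_geometric_progression a \<longrightarrow>
            terms a = A1 \<union> A2 \<longrightarrow> A1 \<inter> A2 = {} \<longrightarrow>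
            contains_three_term_gp A1 \<or> contains_three_term_gp A2)"
proof (intro conjI allI impI)
  fix a A1 A2
  assume prog: "infinite_arithmetic_progression a" and "terms a = A1 \<union> A2"
  then obtain i d S where "i \<ge> 1" "d \<ge> 1" and S: "S \<in> {A1, A2}"
    "a i \<in> S" "a (i + d) \<in> S" "a (i + 2 * d) \<in> S"
    by (elim partition_terms_monochromatic)
  with prog have "contains_three_term_ap S"
    unfolding contains_three_term_ap_def using arithmetic_progression_three_terms by blast
  then show "contains_three_term_ap A1 \<or> contains_three_term_ap A2"
    using S by blast
next
  fix a A1 A2
  assume prog: "infinite_geometric_progression a" and "terms a = A1 \<union> A2"
  then obtain i d S where "i \<ge> 1" "d \<ge> 1" and S: "S \<in> {A1, A2}"
    "a i \<in> S" "a (i + d) \<in> S" "a (i + 2 * d) \<in> S"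
    by (elim partition_terms_monochromatic)
  with prog have "contains_three_term_gp S"
    unfolding contains_three_term_gp_def using geometric_progression_three_terms by blast
  then show "contains_three_term_gp A1 \<or> contains_three_term_gp A2"
    using S by blast
qed

end
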